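(* Let $v\in\mathbb{B}_\xi(\mathcal{X})$ and suppose that the function $w\mapsto v(f(\boldsymbol{x},\boldsymbol{u},w))$ lies in $L^1(\mathrm{d}\nu_N)$ for each $(\boldsymbol{x},\boldsymbol{u})\in\mathbb{K}$. Then the Bellman operator $$(Tv)(\boldsymbol{x}):=\inf_{\boldsymbol{u}\in\mathcal{U}(\boldsymbol{x})}\sup_{\boldsymbol{\mu}\in\mathcal{D}}\Big[c(\boldsymbol{x},\boldsymbol{u})+\alpha\int_{\mathcal{W}}v(f(\boldsymbol{x},\boldsymbol{u},w))\,\boldsymbol{\mu}(\mathrm{d}w)\Big]$$ can be expressed, for each $\boldsymbol{x}\in\mathcal{X}$, as $$\begin{aligned}(Tv)(\boldsymbol{x})=\inf_{\boldsymbol{u},\lambda,\ell}\ &\Big[\lambda\theta^p+c(\boldsymbol{x},\boldsymbol{u})+\frac1N\sum_{i=1}^N\ell_i\Big]\\ \text{s.t. }&\alpha v(f(\boldsymbol{x},\boldsymbol{u},w))-\lambda d(w,\hat w^{(i)})^p\le\ell_i\quad\forall w\in\mathcal{W},\ i=1,\ldots,N,\\ &\boldsymbol{u}\in\mathcal{U}(\boldsymbol{x}),\ \lambda\ge0,\ \ell\in\mathbb{R}^N.\end{aligned}$$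
   Context: $\mathcal{X}\subseteq\mathbb{R}^n$, $\mathcal{U}\subseteq\mathbb{R}^m$, $\mathcal{W}\subseteq\mathbb{R}^l$ are Borel sets; $f$ gives the system dynamics $x_{t+1}=f(x_t,u_t,w_t)$ with values in $\mathcal{X}$; $\mathcal{U}(\boldsymbol{x})\subseteq\mathcal{U}$ is the set of admissible actions at $\boldsymbol{x}$ and $\mathbb{K}:=\{(\boldsymbol{x},\boldsymbol{u})\in\mathcal{X}\times\mathcal{U}\mid\boldsymbol{u}\in\mathcal{U}(\boldsymbol{x})\}$; $c:\mathcal{X}\times\mathcal{U}\to\mathbb{R}$ is the stage cost; $\alpha\in(0,1)$ is the discount factor. $\xi:\mathcal{X}\to[1,\infty)$ is a continuous weight function and $\mathbb{B}_\xi(\mathcal{X})$ is the space of measurable $v:\mathcal{X}\to\mathbb{R}$ with $\|v\|_\xi:=\sup_{\boldsymbol{x}}|v(\boldsymbol{x})|/\xi(\boldsymbol{x})<\infty$. Given samples $\hat w^{(1)},\ldots,\hat w^{(N)}\in\mathcal{W}$, $\nu_N:=\frac1N\sum_{i=1}^N\delta_{\hat w^{(i)}}$. $W_p$ is the Wasserstein distance of order $p\in[1,\infty)$ for a metric $d$ on $\mathcal{W}$: $W_p(\mu,\nu_N):=\min_\kappa[\int_{\mathcal{W}^2}d(w,w')^p\kappa(\mathrm{d}w,\mathrm{d}w')]^{1/p}$ over $\kappa\in\mathcal{P}(\mathcal{W}^2)$ with first marginal $\mu$ and second marginal $\nu_N$. $\mathcal{D}:=\{\mu\in\mathcal{P}(\mathcal{W})\mid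 W_p(\mu,\nu_N)\le\theta\}$ with $\theta>0$, where $\mathcal{P}(\cdot)$ denotes Borel probability measures. *)

theory Defs
  imports "HOL-Probability.Probability"
begin

definition borel_probs :: "'a::topological_space set \<Rightarrow> 'a measure set" where
  "borel_probs S = {\<mu>. prob_space \<mu> \<and> sets \<mu> = sets (restrict_space borel S)}"

(* Values in [-\<infinity>, \<infinity>], so that a measurable g that is not integrable
   is not silently given the value 0 of the Bochner integral.  The truncation ennreal (g w) is
   the positive part of g.  If both parts have infinite integral, ereal subtraction
   yields \<infinity>. *)
definition ext_integral :: "'a measure \<Rightarrow> ('a \<Rightarrow> real) \<Rightarrow> ereal" where
  "ext_integral M g =
     enn2ereal (\<integral>\<^sup>+ w. ennreal (g w) \<partial>M) - enn2ereal (\<integral>\<^sup>+ w. ennreal (- g w) \<partial>M)"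

definition ennreal_powr :: "ennreal \<Rightarrow> real \<Rightarrow> ennreal" where
  "ennreal_powr a r = (if a = \<infinity> then \<infinity> else ennreal (enn2real a powr r))"

definition weighted_norm :: "'a set \<Rightarrow> ('a \<Rightarrow> real) \<Rightarrow> ('a \<Rightarrow> real) \<Rightarrow> ereal" where
  "weighted_norm X \<xi> v = (SUP x\<in>X. ereal (\<bar>v x\<bar> / \<xi> x))"

definition weighted_space :: "'a::topological_space set \<Rightarrow> ('a \<Rightarrow> real) \<Rightarrow> ('a \<Rightarrow> real) set" where
  "weighted_space X \<xi> =
     {v. v \<in> borel_measurable (restrict_space borel X) \<and> weighted_norm X \<xi> v < \<infinity>}"

definition admissible_pairs :: "'x set \<Rightarrow> 'u set \<Rightarrow> ('x \<Rightarrow> 'u set) \<Rightarrow> ('x \<times> 'u) set" where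
  "admissible_pairs X U adm = {(x, u). x \<in> X \<and> u \<in> U \<and> u \<in> adm x}"

definition empirical_measure ::
    "'w::topological_space set \<Rightarrow> nat \<Rightarrow> (nat \<Rightarrow> 'w) \<Rightarrow> 'w measure" where
  "empirical_measure W N what =
     measure_of W (sets (restrict_space borel W))
       (\<lambda>A. (\<Sum>i=1..N. emeasure (return (restrict_space borel W) (what i)) A) / of_nat N)"

(* measure_of falls back to the zero measure if the given set function is not a measure;
   the next two lemmas show that this does not happen. *)
lemma sets_empirical_measure [simp]:
  assumes "W \<in> sets borel"
  shows "sets (empirical_measure W N what) = sets (restrict_space borel W)"
proof -
  have "sigma_algebra W (sets (restrict_space borel W))"
    using sets.sigma_algebra_axioms[of "restrict_space borel W"] assms
    by (simp add: space_restrict_space)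
  then show ?thesis
    unfolding empirical_measure_def
    by (simp add: sigma_algebra.sets_measure_of_eq)
qed

lemma emeasure_empirical_measure:
  assumes "W \<in> sets borel" "A \<in> sets (restrict_space borel W)"
  shows "emeasure (empirical_measure W N what) A = (\<Sum>i=1..N. indicator A (what i)) / of_nat N"
proof -
  let ?M = "restrict_space borel W"
  let ?f = "\<lambda>A. (\<Sum>i=1..N. emeasure (return ?M (what i)) A) / of_nat N"
  have sa: "sigma_algebra W (sets ?M)"
    using sets.sigma_algebra_axioms[of ?M] assms by (simp add: space_restrict_space)
  have "countably_additive (sets ?M) ?f"
  proof (rule countably_additiveI)
    fix B :: "nat \<Rightarrow> 'a set"
    assume B: "range B \<subseteq> sets ?M" "disjoint_family B"
    have "(\<Sum>j. ?f (B j)) = (\<Sum>j. \<Sum>i=1..N. emeasure (return ?M (what i)) (B j)) / of_nat N"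
      by (simp add: divide_ennreal_def)
    also have "(\<Sum>j. \<Sum>i=1..N. emeasure (return ?M (what i)) (B j))
        = (\<Sum>i=1..N. \<Sum>j. emeasure (return ?M (what i)) (B j))"
      by (rule suminf_sum) simp
    also have "\<dots> = (\<Sum>i=1..N. emeasure (return ?M (what i)) (\<Union>j. B j))"
      using B by (intro sum.cong refl suminf_emeasure) auto
    finally show "(\<Sum>j. ?f (B j)) = ?f (\<Union>j. B j)" .
  qed
  moreover have "positive (sets ?M) ?f"
    by (simp add: positive_def)
  ultimately have "emeasure (empirical_measure W N what) A = ?f A"
    unfolding empirical_measure_def
    using sa assms(2) by (intro emeasure_measure_of_sigma) auto
  then show ?thesis using assms(2) by simp
qed

definition couplings ::
    "'w::topological_space set \<Rightarrow> 'w measure \<Rightarrow> 'w measure \<Rightarrow> ('w \<times> 'w) measure set" where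
  "couplings W \<mu> \<nu> = {\<kappa> \<in> borel_probs (W \<times> W).
     distr \<kappa> (restrict_space borel W) fst = \<mu> \<and> distr \<kappa> (restrict_space borel W) snd = \<nu>}"

(* An infimum, which equals the minimum whenever the latter is attained. *)
definition wasserstein ::
    "real \<Rightarrow> ('w \<Rightarrow> 'w \<Rightarrow> real) \<Rightarrow> 'w::topological_space set \<Rightarrow> 'w measure \<Rightarrow> 'w measure \<Rightarrow> ennreal" where
  "wasserstein p d W \<mu> \<nu> =
     (INF \<kappa>\<in>couplings W \<mu> \<nu>.
        ennreal_powr (\<integral>\<^sup>+ z. ennreal (d (fst z) (snd z) powr p) \<partial>\<kappa>) (1 / p))"

definition ambiguity_set ::
    "real \<Rightarrow> ('w \<Rightarrow> 'w \<Rightarrow> real) \<Rightarrow> 'w::topological_space set \<Rightarrow> 'w measure \<Rightarrow> real \<Rightarrow> 'w measure set" where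
  "ambiguity_set p d W \<nu> \<theta> = {\<mu> \<in> borel_probs W. wasserstein p d W \<mu> \<nu> \<le> ennreal \<theta>}"

definition bellman ::
    "('x \<Rightarrow> 'u set) \<Rightarrow> 'w measure set \<Rightarrow> ('x \<Rightarrow> 'u \<Rightarrow> real) \<Rightarrow> ('x \<Rightarrow> 'u \<Rightarrow> 'w \<Rightarrow> 'x) \<Rightarrow> real
      \<Rightarrow> ('x \<Rightarrow> real) \<Rightarrow> 'x \<Rightarrow> ereal" where
  "bellman adm D c f \<alpha> v x =
     (INF u\<in>adm x. SUP \<mu>\<in>D. ereal (c x u) + ereal \<alpha> * ext_integral \<mu> (\<lambda>w. v (f x u w)))"

end

(* Testing against finitely supported couplings with the empirical measure is enough. Their pairs
   (transport cost, expected value) form a convex subset of the plane, and if the worst-case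
   expectation is at most s, this set misses the quadrant of points with cost at most theta^p and
   value above s. A separating line is not vertical, because the diagonal coupling has cost
   0 < theta^p; its slope is the multiplier lambda. Couplings that send the whole mass of each
   sample to a single point then show that the mean of the suprema over w of
   g(w) - lambda d(w, what i)^p is at most s - lambda theta^p. The converse inequality is the
   integral of the dual constraint against a nearly optimal coupling. *)

theory Submission
  imports Defs
begin

section \<open>Finitely supported laws as measures on a given measurable space\<close>

text \<open>\<open>measure_pmf P\<close> is defined on all subsets of the type; pushing it through
  the identity keeps only the sets of \<open>M\<close>, so that a pmf can serve as a Borel measure.
  The restriction to \<open>space M\<close> makes the identity a map into \<open>M\<close>; mass of
  \<open>P\<close> outside is lost, which is why \<open>prob_space_pmf_on\<close> and
  \<open>distr_pmf_on\<close> assume the support inside \<open>space M\<close>.\<close>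

definition pmf_on :: "'a measure \<Rightarrow> 'a pmf \<Rightarrow> 'a measure" where
  "pmf_on M P = distr (restrict_space (measure_pmf P) (space M)) M (\<lambda>x. x)"

lemma sets_pmf_on [simp]: "sets (pmf_on M P) = sets M"
  by (simp add: pmf_on_def)

lemma space_pmf_on [simp]: "space (pmf_on M P) = space M"
  by (simp add: pmf_on_def)

lemma measurable_restrict_pmf:
  "(\<lambda>x. x) \<in> measurable (restrict_space (measure_pmf P) (space M)) M"
proof (rule measurableI)
  fix A assume "A \<in> sets M"
  then have "A \<subseteq> space M" by (rule sets.sets_into_space)
  then show "(\<lambda>x. x) -` A \<inter> space (restrict_space (measure_pmf P) (space M))
      \<in> sets (restrict_space (measure_pmf P) (space M))"
    by (auto simp: space_restrict_space sets_restrict_space)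
qed (simp add: space_restrict_space)

lemma emeasure_pmf_on:
  assumes "A \<in> sets M"
  shows "emeasure (pmf_on M P) A = emeasure (measure_pmf P) A"
proof -
  have "A \<subseteq> space M" using assms by (rule sets.sets_into_space)
  then show ?thesis
    using assms unfolding pmf_on_def
    by (simp add: emeasure_distr measurable_restrict_pmf space_restrict_space
        emeasure_restrict_space Int_absorb2)
qed

lemma prob_space_pmf_on:
  assumes "set_pmf P \<subseteq> space M"
  shows "prob_space (pmf_on M P)"
proof
  have "emeasure (measure_pmf P) (space M) = 1"
    using assms by (intro measure_pmf.emeasure_eq_1_AE) (auto simp: AE_measure_pmf_iff)
  then show "emeasure (pmf_on M P) (space (pmf_on M P)) = 1"
    by (simp add: emeasure_pmf_on)
qed

lemma AE_pmf_on:
  assumes "\<And>x. x \<in> set_pmf P \<Longrightarrow> R x" "{x \<in> space M. R x} \<in> sets M"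
  shows "AE x in pmf_on M P. R x"
  unfolding pmf_on_def
  using assms by (subst AE_distr_iff[OF measurable_restrict_pmf])
    (auto simp: AE_restrict_space_iff AE_measure_pmf_iff)

lemma distr_pmf_on:
  assumes "h \<in> measurable M M'" "set_pmf P \<subseteq> space M"
  shows "distr (pmf_on M P) M' h = pmf_on M' (map_pmf h P)"
proof (rule measure_eqI)
  fix A assume "A \<in> sets (distr (pmf_on M P) M' h)"
  then have A: "A \<in> sets M'" by simp
  have h: "h \<in> measurable (pmf_on M P) M'"
    using assms(1) by (simp cong: measurable_cong_sets)
  have "emeasure (distr (pmf_on M P) M' h) A = emeasure (measure_pmf P) (h -` A \<inter> space M)"
    using A assms(1) by (simp add: emeasure_distr[OF h] emeasure_pmf_on measurable_sets)
  also have "\<dots> = emeasure (measure_pmf P) (h -` A)"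
    using assms(2) by (intro emeasure_eq_AE) (auto simp: AE_measure_pmf_iff)
  also have "\<dots> = emeasure (pmf_on M' (map_pmf h P)) A"
    using A by (simp add: emeasure_pmf_on)
  finally show "emeasure (distr (pmf_on M P) M' h) A = emeasure (pmf_on M' (map_pmf h P)) A" .
qed simp

lemma
  fixes g :: "'a \<Rightarrow> real"
  assumes "g \<in> borel_measurable M" "set_pmf P \<subseteq> space M" "finite (set_pmf P)"
  shows integrable_pmf_on: "integrable (pmf_on M P) g"
    and integral_pmf_on: "integral\<^sup>L (pmf_on M P) g = measure_pmf.expectation P g"
proof -
  have *: "integrable (measure_pmf P) (\<lambda>x. indicator (space M) x *\<^sub>R g x)"
    using assms(3) by (rule integrable_measure_pmf_finite)
  show "integrable (pmf_on M P) g"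
    unfolding pmf_on_def using assms(1) *
    by (simp add: integrable_distr_eq[OF measurable_restrict_pmf] integrable_restrict_space
        set_integrable_def)
  have "integral\<^sup>L (pmf_on M P) g = measure_pmf.expectation P (\<lambda>x. indicator (space M) x *\<^sub>R g x)"
    unfolding pmf_on_def using assms(1)
    by (simp add: integral_distr[OF measurable_restrict_pmf] integral_restrict_space
        set_lebesgue_integral_def)
  also have "\<dots> = measure_pmf.expectation P g"
    using assms(2) by (intro integral_cong_AE) (auto simp: AE_measure_pmf_iff)
  finally show "integral\<^sup>L (pmf_on M P) g = measure_pmf.expectation P g" .
qed

section \<open>Extended integrals, p-th roots and sums of suprema\<close>

lemma ext_integral_eq_integral:
  assumes "integrable M g"
  shows "ext_integral M g = ereal (integral\<^sup>L M g)"
proof -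
  have fin: "(\<integral>\<^sup>+ w. ennreal (g w) \<partial>M) \<noteq> \<infinity>" "(\<integral>\<^sup>+ w. ennreal (- g w) \<partial>M) \<noteq> \<infinity>"
    using assms by (auto simp: real_integrable_def)
  have *: "enn2ereal a = ereal (enn2real a)" if "a \<noteq> \<infinity>" for a
    using that by (cases a) auto
  show ?thesis
    using assms by (simp add: ext_integral_def real_lebesgue_integral_def *[OF fin(1)] *[OF fin(2)])
qed

text \<open>Translates between a bound on the Wasserstein distance and a bound on the transport cost
  before the root is taken.\<close>

lemma ennreal_powr_inverse_le_iff:
  assumes "0 < p" "0 \<le> t"
  shows "ennreal_powr a (1 / p) \<le> ennreal t \<longleftrightarrow> a \<le> ennreal (t powr p)"
proof (cases a)
  case (real r)
  have "r powr (1 / p) \<le> t \<longleftrightarrow> r \<le> t powr p"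
  proof
    assume "r powr (1 / p) \<le> t"
    then have "(r powr (1 / p)) powr p \<le> t powr p"
      using assms by (intro powr_mono2) auto
    then show "r \<le> t powr p"
      using assms real by (simp add: powr_powr)
  next
    assume "r \<le> t powr p"
    then have "r powr (1 / p) \<le> (t powr p) powr (1 / p)"
      using assms real by (intro powr_mono2) auto
    then show "r powr (1 / p) \<le> t"
      using assms by (simp add: powr_powr)
  qed
  then show ?thesis
    using assms real by (simp add: ennreal_powr_def)
qed (use assms in \<open>auto simp: ennreal_powr_def top_unique\<close>)

text \<open>The points \<open>k i\<close> are chosen independently of each other, so the supremum of
  the sum is the sum of the suprema, and \<open>l i\<close> can be the supremum of
  \<open>F i\<close>. A bound on all sums also makes each single supremum finite.\<close>

lemma sum_of_suprema:
  fixes F :: "'i \<Rightarrow> 'w \<Rightarrow> real"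
  assumes "finite I" "\<And>i. i \<in> I \<Longrightarrow> w0 i \<in> W"
    and le: "\<And>k. (\<And>i. i \<in> I \<Longrightarrow> k i \<in> W) \<Longrightarrow> (\<Sum>i\<in>I. F i (k i)) \<le> C"
  obtains l where "\<And>i w. i \<in> I \<Longrightarrow> w \<in> W \<Longrightarrow> F i w \<le> l i" "sum l I \<le> C"
proof -
  have bdd: "bdd_above (F i ` W)" if "i \<in> I" for i
  proof (rule bdd_aboveI2)
    \<comment> \<open>Only coordinate \<open>i\<close> of the base selection \<open>w0\<close>
      moves; the other summands are constants.\<close>
    fix w assume "w \<in> W"
    then have "(\<Sum>j\<in>I. F j ((w0(i := w)) j)) \<le> C"
      using assms(2) by (intro le) auto
    moreover have "(\<Sum>j\<in>I. F j ((w0(i := w)) j)) = F i w + (\<Sum>j\<in>I - {i}. F j (w0 j))"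
      using assms(1) that by (simp add: sum.remove)
    ultimately show "F i w \<le> C - (\<Sum>j\<in>I - {i}. F j (w0 j))" by simp
  qed
  define l where "l i = (SUP w\<in>W. F i w)" for i
  have "sum l I \<le> C + e" if "0 < e" for e
  proof -
    \<comment> \<open>The added 1 keeps \<open>\<delta>\<close> positive when \<open>I\<close> is
      empty.\<close>
    define \<delta> where "\<delta> = e / (real (card I) + 1)"
    have \<delta>: "0 < \<delta>" "real (card I) * \<delta> \<le> e"
      using that by (auto simp: \<delta>_def field_simps)
    have "\<exists>w\<in>W. l i - \<delta> < F i w" if "i \<in> I" for i
      using less_cSUP_iff[of W "F i" "l i - \<delta>"] bdd[OF that] assms(2)[OF that] \<delta>(1)
      by (auto simp: l_def)
    then obtain k where k: "\<And>i. i \<in> I \<Longrightarrow> k i \<in> W \<and> l i - \<delta> < F i (k i)" by metis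
    have "sum l I - real (card I) * \<delta> = (\<Sum>i\<in>I. l i - \<delta>)"
      by (simp add: sum_subtractf)
    also have "\<dots> \<le> (\<Sum>i\<in>I. F i (k i))"
      using k by (intro sum_mono) (auto intro: less_imp_le)
    also have "\<dots> \<le> C" using k by (intro le) auto
    finally show ?thesis using \<delta> by simp
  qed
  then have "sum l I \<le> C" by (rule field_le_epsilon)
  moreover have "F i w \<le> l i" if "i \<in> I" "w \<in> W" for i w
    unfolding l_def using bdd[OF that(1)] that(2) by (rule cSUP_upper2) simp
  ultimately show thesis using that by blast
qed

section \<open>The empirical measure and its Wasserstein ball\<close>

text \<open>The metric \<open>d\<close> is tied to the Borel sets by \<open>d_meas\<close>, and the
  class \<open>t1_space\<close> makes the finite set of samples closed, hence Borel.\<close>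

locale wasserstein_ball = Metric_space W d
  for W :: "'w::t1_space set" and d :: "'w \<Rightarrow> 'w \<Rightarrow> real" +
  fixes p \<theta> :: real and N :: nat and what :: "nat \<Rightarrow> 'w"
  assumes W [measurable]: "W \<in> sets borel"
    and d_meas: "(\<lambda>z. d (fst z) (snd z)) \<in> borel_measurable (restrict_space borel (W \<times> W))"
    and p: "1 \<le> p" and \<theta>: "0 < \<theta>" and N: "1 \<le> N"
    and what: "\<And>i. i \<in> {1..N} \<Longrightarrow> what i \<in> W"
begin

abbreviation "BW \<equiv> restrict_space borel W"
abbreviation "BWW \<equiv> restrict_space borel (W \<times> W)"
abbreviation "\<nu> \<equiv> empirical_measure W N what"
abbreviation "\<nu>_pmf \<equiv> map_pmf what (pmf_of_set {1..N})"
abbreviation "cost z \<equiv> d (fst z) (snd z) powr p"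

lemma space_BW: "space BW = W" and space_BWW: "space BWW = W \<times> W"
  by (simp_all add: space_restrict_space)

lemma N_sets: "finite {1..N}" "{1..N} \<noteq> {}"
  using N by auto

lemma set_\<nu>_pmf: "set_pmf \<nu>_pmf = what ` {1..N}"
  using N_sets by simp

lemma cost_meas: "cost \<in> borel_measurable BWW"
  using d_meas by measurable

lemma fst_meas: "fst \<in> measurable BWW BW"
proof (rule measurable_restrict_space3)
  show "fst \<in> measurable borel borel"
    by (intro borel_measurable_continuous_onI continuous_intros)
qed auto

lemma snd_meas: "snd \<in> measurable BWW BW"
proof (rule measurable_restrict_space3)
  show "snd \<in> measurable borel borel"
    by (intro borel_measurable_continuous_onI continuous_intros)
qed auto

text \<open>The uniform law on the indices carries the multiplicity of repeated samples. Marginal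
  conditions against \<open>\<nu>\<close> thereby become equations between pmfs.\<close>

lemma empirical_measure_eq: "\<nu> = pmf_on BW \<nu>_pmf"
proof (rule measure_eqI)
  fix A assume "A \<in> sets \<nu>"
  then have A: "A \<in> sets BW" using W by simp
  have "emeasure (pmf_on BW \<nu>_pmf) A = emeasure (measure_pmf (pmf_of_set {1..N})) (what -` A)"
    using A by (simp add: emeasure_pmf_on)
  also have "\<dots> = (\<integral>\<^sup>+ i. indicator A (what i) \<partial>measure_pmf (pmf_of_set {1..N}))"
    by (simp flip: nn_integral_indicator add: indicator_vimage)
  also have "\<dots> = (\<Sum>i=1..N. indicator A (what i)) / of_nat N"
    using N_sets by (simp add: nn_integral_pmf_of_set)
  finally show "emeasure \<nu> A = emeasure (pmf_on BW \<nu>_pmf) A"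
    using emeasure_empirical_measure[OF W A] by simp
qed (use W in simp)

section \<open>Weak duality\<close>

text \<open>The dual constraint is integrated against \<open>\<kappa>\<close>: the first marginal
  yields the integral of \<open>g\<close>, the cost term is at most \<open>lam * t\<close>, and the
  second marginal turns the multipliers into their mean.\<close>

lemma ext_integral_le_of_coupling:
  assumes \<kappa>: "\<kappa> \<in> couplings W \<mu> \<nu>"
    and t: "(\<integral>\<^sup>+ z. ennreal (cost z) \<partial>\<kappa>) \<le> ennreal t" "0 \<le> t"
    and g: "g \<in> borel_measurable BW"
    and lam: "0 \<le> lam"
    and feas: "\<And>w i. w \<in> W \<Longrightarrow> i \<in> {1..N} \<Longrightarrow> g w - lam * d w (what i) powr p \<le> l i"
  shows "ext_integral \<mu> g \<le> ereal (lam * t + (\<Sum>i=1..N. l i) / real N)"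
proof -
  have sets_\<kappa>: "sets \<kappa> = sets BWW" and \<mu>: "distr \<kappa> BW fst = \<mu>" and \<nu>: "distr \<kappa> BW snd = \<nu>"
    using \<kappa> by (auto simp: couplings_def borel_probs_def)
  have space_\<kappa>: "space \<kappa> = W \<times> W"
    using sets_eq_imp_space_eq[OF sets_\<kappa>] by (simp add: space_BWW)
  have fst_\<kappa>: "fst \<in> measurable \<kappa> BW" and snd_\<kappa>: "snd \<in> measurable \<kappa> BW"
    and cost_\<kappa>: "cost \<in> borel_measurable \<kappa>"
    using fst_meas snd_meas cost_meas by (simp_all cong: measurable_cong_sets add: sets_\<kappa>)
  \<comment> \<open>Samples may repeat, so the multipliers are first made a function of the sample point.\<close>
  define m where "m y = Min (l ` {i \<in> {1..N}. what i = y})" for y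
  define L where "L y = (\<Sum>y0\<in>what ` {1..N}. m y0 * indicator {y0} y)" for y
  have L_eq: "L y = m y" if "y \<in> what ` {1..N}" for y
    unfolding L_def using that by (simp add: indicator_def sum.delta' if_distrib cong: if_cong)
  \<comment> \<open>The minimum over all indices of one sample point is below each of their
    multipliers, and being one of them it still satisfies the constraint.\<close>
  have L_le: "L (what i) \<le> l i" if "i \<in> {1..N}" for i
    using that by (subst L_eq) (auto simp: m_def intro!: Min_le)
  have L_feas: "g w - lam * d w y powr p \<le> L y" if "w \<in> W" "y \<in> what ` {1..N}" for w y
  proof -
    have "m y \<in> l ` {i \<in> {1..N}. what i = y}"
      unfolding m_def using that by (intro Min_in) auto
    then show ?thesis using L_eq[OF that(2)] feas[OF that(1)] by auto
  qed
  have L_meas: "L \<in> borel_measurable BW"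
  proof -
    have "{y} \<in> sets borel" for y :: 'w by simp
    then have "L \<in> borel_measurable borel" unfolding L_def by measurable
    then show ?thesis by (rule measurable_restrict_space1)
  qed
  have L_int: "integrable \<nu> L"
    and L_integral: "integral\<^sup>L \<nu> L = (\<Sum>i=1..N. L (what i)) / real N"
    using what N_sets L_meas unfolding empirical_measure_eq
    by (auto simp: space_BW integrable_pmf_on integral_pmf_on integral_pmf_of_set image_subset_iff)
  have L\<kappa>: "integrable \<kappa> (\<lambda>z. L (snd z))"
    using L_int L_meas by (simp add: integrable_distr_eq[OF snd_\<kappa>] flip: \<nu>)
  have L\<kappa>_integral: "(\<integral>z. L (snd z) \<partial>\<kappa>) = integral\<^sup>L \<nu> L"
    using L_meas by (simp add: integral_distr[OF snd_\<kappa>] flip: \<nu>)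
  have cost_int: "integrable \<kappa> cost"
    using t(1) cost_\<kappa> by (intro integrableI_nonneg) (auto simp: le_less_trans)
  have "ennreal (integral\<^sup>L \<kappa> cost) \<le> ennreal t"
    using t(1) by (subst nn_integral_eq_integral[symmetric]) (auto intro: cost_int)
  then have cost_le: "integral\<^sup>L \<kappa> cost \<le> t"
    using t(2) by simp
  define h where "h z = lam * cost z + L (snd z)" for z
  have h_int: "integrable \<kappa> h"
    unfolding h_def using cost_int L\<kappa> by simp
  \<comment> \<open>The constraint is available only when the second coordinate is a sample;
    \<open>\<nu>\<close> charges nothing else, and this pulls back to \<open>\<kappa>\<close> along
    \<open>snd\<close>.\<close>
  have "AE y in \<nu>. y \<in> what ` {1..N}"
    unfolding empirical_measure_eq
  proof (rule AE_pmf_on)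
    have "finite (what ` {1..N})" by simp
    then have "what ` {1..N} \<in> sets borel" by (rule borel_closed[OF finite_imp_closed])
    moreover have "{y \<in> space BW. y \<in> what ` {1..N}} = what ` {1..N} \<inter> W"
      by (auto simp: space_BW)
    ultimately show "{y \<in> space BW. y \<in> what ` {1..N}} \<in> sets BW"
      by (auto simp: sets_restrict_space)
  qed (simp only: set_\<nu>_pmf)
  then have "AE z in \<kappa>. snd z \<in> what ` {1..N}"
    unfolding \<nu>[symmetric] by (rule AE_distrD[OF snd_\<kappa>])
  moreover have "AE z in \<kappa>. fst z \<in> W"
    by (rule AE_I2) (simp add: space_\<kappa> mem_Times_iff)
  ultimately have le: "AE z in \<kappa>. g (fst z) \<le> h z"
  proof eventually_elim
    case (elim z)
    then show ?case using L_feas[OF elim(2) elim(1)] by (simp add: h_def)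
  qed
  \<comment> \<open>The positive part of \<open>g\<close> is dominated by that of the integrable
    \<open>h\<close>, which rules out the undetermined difference of two infinities. If the negative
    part has infinite integral, \<open>ext_integral\<close> is minus infinity.\<close>
  have "(\<integral>\<^sup>+ w. ennreal (g w) \<partial>\<mu>) = (\<integral>\<^sup>+ z. ennreal (g (fst z)) \<partial>\<kappa>)"
    using g by (simp add: nn_integral_distr[OF fst_\<kappa>] flip: \<mu>)
  also have "\<dots> \<le> (\<integral>\<^sup>+ z. ennreal (h z) \<partial>\<kappa>)"
    using le by (intro nn_integral_mono_AE) (auto elim!: eventually_mono intro: ennreal_leI)
  also have "\<dots> < \<infinity>"
    using h_int by (auto simp: real_integrable_def less_top)
  finally have pos: "(\<integral>\<^sup>+ w. ennreal (g w) \<partial>\<mu>) < \<infinity>" .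
  show ?thesis
  proof (cases "(\<integral>\<^sup>+ w. ennreal (- g w) \<partial>\<mu>) = \<infinity>")
    case True
    then show ?thesis
      using pos by (cases "\<integral>\<^sup>+ w. ennreal (g w) \<partial>\<mu>") (auto simp: ext_integral_def)
  next
    case False
    then have g_int: "integrable \<mu> g"
      using pos g by (auto simp: real_integrable_def simp flip: \<mu>)
    then have g\<kappa>: "integrable \<kappa> (\<lambda>z. g (fst z))"
      using g by (simp add: integrable_distr_eq[OF fst_\<kappa>] flip: \<mu>)
    have "integral\<^sup>L \<mu> g = (\<integral>z. g (fst z) \<partial>\<kappa>)"
      using g by (simp add: integral_distr[OF fst_\<kappa>] flip: \<mu>)
    also have "\<dots> \<le> integral\<^sup>L \<kappa> h"
      using g\<kappa> h_int le by (rule integral_mono_AE)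
    also have "\<dots> = lam * integral\<^sup>L \<kappa> cost + (\<Sum>i=1..N. L (what i)) / real N"
      unfolding h_def using cost_int L\<kappa> L\<kappa>_integral L_integral by simp
    also have "\<dots> \<le> lam * t + (\<Sum>i=1..N. l i) / real N"
      using cost_le lam L_le by (intro add_mono mult_left_mono divide_right_mono sum_mono) auto
    finally show ?thesis
      by (simp add: ext_integral_eq_integral[OF g_int])
  qed
qed

text \<open>The infimum defining \<open>wasserstein\<close> need not come with a minimizer. For each
  \<open>s\<close> above \<theta> some coupling has cost at most \<open>s powr p\<close>; the
  resulting bound is continuous in \<open>s\<close> and passes to the limit at \<theta>.\<close>

lemma weak_duality:
  assumes \<mu>: "\<mu> \<in> ambiguity_set p d W \<nu> \<theta>"
    and g: "g \<in> borel_measurable BW"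
    and lam: "0 \<le> lam"
    and feas: "\<And>w i. w \<in> W \<Longrightarrow> i \<in> {1..N} \<Longrightarrow> g w - lam * d w (what i) powr p \<le> l i"
  shows "ext_integral \<mu> g \<le> ereal (lam * \<theta> powr p + (\<Sum>i=1..N. l i) / real N)"
proof -
  define B where "B s = lam * s powr p + (\<Sum>i=1..N. l i) / real N" for s
  have le: "ext_integral \<mu> g \<le> ereal (B s)" if s: "\<theta> < s" for s
  proof -
    have "wasserstein p d W \<mu> \<nu> < ennreal s"
      using \<mu> s \<theta> by (auto simp: ambiguity_set_def ennreal_lessI intro: le_less_trans)
    then obtain \<kappa> where \<kappa>: "\<kappa> \<in> couplings W \<mu> \<nu>"
      and "ennreal_powr (\<integral>\<^sup>+ z. ennreal (cost z) \<partial>\<kappa>) (1 / p) < ennreal s"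
      by (auto simp: wasserstein_def INF_less_iff)
    then have "(\<integral>\<^sup>+ z. ennreal (cost z) \<partial>\<kappa>) \<le> ennreal (s powr p)"
      using p s \<theta> by (subst ennreal_powr_inverse_le_iff[symmetric]) auto
    from ext_integral_le_of_coupling[OF \<kappa> this _ g lam feas] show ?thesis
      by (simp add: B_def)
  qed
  have "((\<lambda>s. ereal (B s)) \<longlongrightarrow> ereal (B \<theta>)) (at_right \<theta>)"
    unfolding B_def using \<theta> by (intro tendsto_intros) auto
  moreover have "\<forall>\<^sub>F s in at_right \<theta>. ext_integral \<mu> g \<le> ereal (B s)"
    using eventually_at_right_less[of \<theta>] by (rule eventually_mono) (rule le)
  ultimately have "ext_integral \<mu> g \<le> ereal (B \<theta>)"
    by (rule tendsto_lowerbound) simp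
  then show ?thesis by (simp add: B_def)
qed

section \<open>Finitely supported couplings with the empirical measure\<close>

text \<open>Only the second marginal is prescribed; the first is the candidate distribution. Finite
  support makes all expectations finite sums.\<close>

definition finite_coupling :: "('w \<times> 'w) pmf \<Rightarrow> bool" where
  "finite_coupling P \<longleftrightarrow>
     finite (set_pmf P) \<and> set_pmf P \<subseteq> W \<times> W \<and> map_pmf snd P = \<nu>_pmf"

text \<open>The plan moves the mass 1/N of index \<open>i\<close> to the point \<open>k i\<close>.
  Working with indices lets copies of one sample go to different points.\<close>

lemma finite_coupling_selection:
  assumes "\<And>i. i \<in> {1..N} \<Longrightarrow> k i \<in> W"
  shows "finite_coupling (map_pmf (\<lambda>i. (k i, what i)) (pmf_of_set {1..N}))"
  using assms what N_sets by (auto simp: finite_coupling_def map_pmf_comp)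

lemma expectation_selection:
  fixes F :: "'w \<times> 'w \<Rightarrow> real"
  shows "measure_pmf.expectation (map_pmf (\<lambda>i. (k i, what i)) (pmf_of_set {1..N})) F
    = (\<Sum>i=1..N. F (k i, what i)) / real N"
  using N_sets by (simp add: integral_pmf_of_set)

text \<open>A biased coin decides between \<open>P\<close> and \<open>Q\<close>; their common second
  marginal is unaffected. This is the convexity used in the separation argument.\<close>

lemma finite_coupling_mixture:
  assumes "finite_coupling P" "finite_coupling Q" "0 \<le> u" "u \<le> 1"
  obtains R where "finite_coupling R"
    "\<And>F :: 'w \<times> 'w \<Rightarrow> real. measure_pmf.expectation R F =
       u * measure_pmf.expectation P F + (1 - u) * measure_pmf.expectation Q F"
proof
  let ?R = "bernoulli_pmf u \<bind> (\<lambda>b. if b then P else Q)"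
  have "map_pmf snd ?R = bernoulli_pmf u \<bind> (\<lambda>b. \<nu>_pmf)"
    unfolding map_bind_pmf using assms(1,2) by (intro bind_pmf_cong) (auto simp: finite_coupling_def)
  moreover have "set_pmf ?R \<subseteq> set_pmf P \<union> set_pmf Q"
    by (auto split: if_splits)
  ultimately show "finite_coupling ?R"
    using assms(1,2) by (auto simp: finite_coupling_def bind_pmf_const intro: finite_subset)
  fix F :: "'w \<times> 'w \<Rightarrow> real"
  have "measure_pmf.expectation ?R F =
      (\<Sum>b\<in>UNIV. pmf (bernoulli_pmf u) b *\<^sub>R measure_pmf.expectation (if b then P else Q) F)"
    using assms(1,2) by (intro pmf_expectation_bind) (auto simp: finite_coupling_def)
  then show "measure_pmf.expectation ?R F =
       u * measure_pmf.expectation P F + (1 - u) * measure_pmf.expectation Q F"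
    using assms(3,4) by (simp add: UNIV_bool)
qed

text \<open>As a Borel measure, \<open>P\<close> couples its first marginal with
  \<open>\<nu>\<close>, so its cost bounds the infimum in \<open>wasserstein\<close>. That first
  marginal is the witness.\<close>

lemma finite_coupling_ambiguity:
  assumes P: "finite_coupling P" and cost: "measure_pmf.expectation P cost \<le> \<theta> powr p"
    and g: "g \<in> borel_measurable BW"
  shows "\<exists>\<mu>\<in>ambiguity_set p d W \<nu> \<theta>.
    ext_integral \<mu> g = ereal (measure_pmf.expectation P (\<lambda>z. g (fst z)))"
proof
  let ?\<kappa> = "pmf_on BWW P" and ?\<mu> = "pmf_on BW (map_pmf fst P)"
  have fin: "finite (set_pmf P)" and sub: "set_pmf P \<subseteq> space BWW" and snd: "map_pmf snd P = \<nu>_pmf"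
    using P by (auto simp: finite_coupling_def space_BWW)
  have sub': "set_pmf (map_pmf fst P) \<subseteq> space BW"
    using sub by (auto simp: space_BW space_BWW)
  have \<kappa>: "?\<kappa> \<in> couplings W ?\<mu> \<nu>"
    using sub by (auto simp: couplings_def borel_probs_def prob_space_pmf_on distr_pmf_on
        fst_meas snd_meas snd empirical_measure_eq)
  have "(\<integral>\<^sup>+ z. ennreal (cost z) \<partial>?\<kappa>) = ennreal (measure_pmf.expectation P cost)"
    by (simp add: nn_integral_eq_integral integrable_pmf_on integral_pmf_on cost_meas sub fin)
  also have "\<dots> \<le> ennreal (\<theta> powr p)"
    using cost by (rule ennreal_leI)
  finally have "ennreal_powr (\<integral>\<^sup>+ z. ennreal (cost z) \<partial>?\<kappa>) (1 / p) \<le> ennreal \<theta>"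
    using p \<theta> by (subst ennreal_powr_inverse_le_iff) auto
  then have "wasserstein p d W ?\<mu> \<nu> \<le> ennreal \<theta>"
    unfolding wasserstein_def using \<kappa> by (rule INF_lower2[rotated])
  then show "?\<mu> \<in> ambiguity_set p d W \<nu> \<theta>"
    using sub' by (simp add: ambiguity_set_def borel_probs_def prob_space_pmf_on)
  show "ext_integral ?\<mu> g = ereal (measure_pmf.expectation P (\<lambda>z. g (fst z)))"
    using g sub' fin by (simp add: ext_integral_eq_integral integrable_pmf_on integral_pmf_on)
qed

section \<open>Strong duality by separation in the plane\<close>

text \<open>Allowing any real bound \<open>s\<close>, not just the supremum, avoids a separate case
  for an infinite supremum. The multipliers reach \<open>s\<close> without an error term.\<close>

lemma strong_duality:
  assumes g: "g \<in> borel_measurable BW"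
    and bound: "\<And>\<mu>. \<mu> \<in> ambiguity_set p d W \<nu> \<theta> \<Longrightarrow> ext_integral \<mu> g \<le> ereal s"
  obtains lam l where "0 \<le> lam"
    "\<And>w i. w \<in> W \<Longrightarrow> i \<in> {1..N} \<Longrightarrow> g w - lam * d w (what i) powr p \<le> l i"
    "lam * \<theta> powr p + (\<Sum>i=1..N. l i) / real N \<le> s"
proof -
  let ?E = "measure_pmf.expectation"
  define A where "A = (\<lambda>P. (?E P cost, ?E P (\<lambda>z. g (fst z)))) ` {P. finite_coupling P}"
  \<comment> \<open>Closed in the cost and open in the value, to match the non-strict radius of the
    ball and the non-strict bound \<open>s\<close>.\<close>
  define B where "B = {..\<theta> powr p} \<times> {s<..}"
  have selection: "((\<Sum>i=1..N. d (k i) (what i) powr p) / real N, (\<Sum>i=1..N. g (k i)) / real N) \<in> A"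
    if "\<And>i. i \<in> {1..N} \<Longrightarrow> k i \<in> W" for k
    unfolding A_def
  proof (rule image_eqI[where x = "map_pmf (\<lambda>i. (k i, what i)) (pmf_of_set {1..N})"])
    show "map_pmf (\<lambda>i. (k i, what i)) (pmf_of_set {1..N}) \<in> {P. finite_coupling P}"
      by (intro CollectI finite_coupling_selection that)
  qed (simp only: expectation_selection fst_conv snd_conv)
  have "convex A"
    unfolding convex_alt
  proof (intro ballI allI impI)
    fix x y :: "real \<times> real" and u :: real
    assume "x \<in> A" "y \<in> A" and u: "0 \<le> u \<and> u \<le> 1"
    then obtain P Q where P: "finite_coupling P" "y = (?E P cost, ?E P (\<lambda>z. g (fst z)))"
      and Q: "finite_coupling Q" "x = (?E Q cost, ?E Q (\<lambda>z. g (fst z)))"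
      by (auto simp: A_def)
    obtain R where R: "finite_coupling R"
      "\<And>F :: 'w \<times> 'w \<Rightarrow> real. ?E R F = u * ?E P F + (1 - u) * ?E Q F"
      using finite_coupling_mixture[OF P(1) Q(1)] u by blast
    show "(1 - u) *\<^sub>R x + u *\<^sub>R y \<in> A"
      unfolding A_def using R(1) by (intro image_eqI[where x = R]) (simp_all add: P Q R(2))
  qed
  moreover have "convex B"
    unfolding B_def by (intro convex_Times) auto
  moreover have "A \<noteq> {}" using selection[of what] what by blast
  moreover have "B \<noteq> {}" by (auto simp: B_def)
  moreover have "A \<inter> B = {}"
  proof -
    have "?E P (\<lambda>z. g (fst z)) \<le> s" if "finite_coupling P" "?E P cost \<le> \<theta> powr p" for P
      using finite_coupling_ambiguity[OF that g] bound by fastforce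
    then show ?thesis by (fastforce simp: A_def B_def)
  qed
  ultimately obtain q \<beta> where q: "q \<noteq> 0" and qA: "\<And>x. x \<in> A \<Longrightarrow> q \<bullet> x \<le> \<beta>"
    and qB: "\<And>x. x \<in> B \<Longrightarrow> \<beta> \<le> q \<bullet> x"
    using separating_hyperplane_sets by metis
  obtain a b where ab: "q = (a, b)" by (cases q)
  have qA': "a * x + b * y \<le> \<beta>" if "(x, y) \<in> A" for x y
    using qA[OF that] by (simp add: ab)
  have qB': "\<beta> \<le> a * x + b * y" if "x \<le> \<theta> powr p" "s < y" for x y
    using qB[of "(x, y)"] that by (simp add: ab B_def)
  have a: "a \<le> 0"
  proof (rule ccontr)
    assume "\<not> a \<le> 0"
    \<comment> \<open>\<open>B\<close> extends to arbitrarily negative cost. This \<open>x\<close>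
      brings the functional at \<open>(x, s + 1)\<close> down to at most \<open>\<beta> - 1\<close>,
      although that point lies in \<open>B\<close>.\<close>
    define x where "x = min (\<theta> powr p) ((\<beta> - b * (s + 1) - 1) / a)"
    have "a * x \<le> a * ((\<beta> - b * (s + 1) - 1) / a)"
      using \<open>\<not> a \<le> 0\<close> by (intro mult_left_mono) (auto simp: x_def)
    then have "a * x \<le> \<beta> - b * (s + 1) - 1" using \<open>\<not> a \<le> 0\<close> by simp
    then show False using qB'[of x "s + 1"] by (simp add: x_def)
  qed
  have b: "0 \<le> b"
  proof (rule ccontr)
    assume "\<not> 0 \<le> b"
    \<comment> \<open>The same device in the direction of large values: at
      \<open>(\<theta> powr p, y)\<close> the functional is at most
      \<open>\<beta> - 1\<close>.\<close>
    define y where "y = max (s + 1) ((\<beta> - a * \<theta> powr p - 1) / b)"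
    have "b * y \<le> b * ((\<beta> - a * \<theta> powr p - 1) / b)"
      using \<open>\<not> 0 \<le> b\<close> by (intro mult_left_mono_neg) (auto simp: y_def)
    then have "b * y \<le> \<beta> - a * \<theta> powr p - 1" using \<open>\<not> 0 \<le> b\<close> by simp
    moreover have "s < y" by (simp add: y_def less_max_iff_disj)
    ultimately show False using qB'[of "\<theta> powr p" y] by simp
  qed
  have "b \<noteq> 0"
  proof
    \<comment> \<open>Slater's condition: the empirical measure itself has transport cost 0, and \<open>0 < \<theta>\<close>.\<close>
    assume "b = 0"
    have "(0, (\<Sum>i=1..N. g (what i)) / real N) \<in> A"
      using selection[of what] what p by simp
    then have "0 \<le> \<beta>" using qA' \<open>b = 0\<close> by fastforce
    moreover have "\<beta> \<le> a * \<theta> powr p" using qB'[of "\<theta> powr p" "s + 1"] \<open>b = 0\<close> by simp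
    moreover have "a \<noteq> 0" using q ab \<open>b = 0\<close> by (simp add: zero_prod_def)
    ultimately show False using a \<theta> by (smt (verit) mult_neg_pos powr_gt_zero)
  qed
  with b have b: "0 < b" by simp
  define lam where "lam = - a / b"
  \<comment> \<open>The corner \<open>(\<theta> powr p, s)\<close> is not in \<open>B\<close>, so it
    is approached from above in the value; the offset \<open>e / b\<close> costs exactly
    \<open>e\<close>.\<close>
  have \<beta>: "\<beta> \<le> a * \<theta> powr p + b * s"
  proof (rule field_le_epsilon)
    fix e :: real assume "0 < e"
    then show "\<beta> \<le> a * \<theta> powr p + b * s + e"
      using qB'[of "\<theta> powr p" "s + e / b"] b by (simp add: algebra_simps)
  qed
  \<comment> \<open>All attainable pairs lie on or below the line of slope \<open>lam\<close>
    through the corner.\<close>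
  have A_le: "y - lam * x \<le> s - lam * \<theta> powr p" if "(x, y) \<in> A" for x y
  proof -
    have "a * x + b * y \<le> a * \<theta> powr p + b * s"
      using qA'[OF that] \<beta> by simp
    moreover have "b * lam = - a" using b by (simp add: lam_def)
    then have "b * (y - lam * x) = a * x + b * y"
      and "b * (s - lam * \<theta> powr p) = a * \<theta> powr p + b * s"
      by (simp_all add: right_diff_distrib flip: mult.assoc)
    ultimately show ?thesis using b by (metis mult_le_cancel_left_pos)
  qed
  have selection_le: "(\<Sum>i=1..N. g (k i) - lam * d (k i) (what i) powr p) \<le> real N * (s - lam * \<theta> powr p)"
    if "\<And>i. i \<in> {1..N} \<Longrightarrow> k i \<in> W" for k
  proof -
    let ?G = "\<Sum>i=1..N. g (k i)" and ?C = "\<Sum>i=1..N. d (k i) (what i) powr p"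
    have "?G / real N - lam * (?C / real N) \<le> s - lam * \<theta> powr p"
      by (rule A_le, rule selection, rule that)
    then have "real N * (?G / real N - lam * (?C / real N)) \<le> real N * (s - lam * \<theta> powr p)"
      by (intro mult_left_mono) auto
    moreover have "real N * (?G / real N - lam * (?C / real N)) = ?G - lam * ?C"
      using N by (simp add: right_diff_distrib)
    ultimately show ?thesis
      by (simp only: sum_subtractf sum_distrib_left)
  qed
  \<comment> \<open>The bound for all selections now splits into one multiplier per sample.\<close>
  obtain l where l: "\<And>i w. i \<in> {1..N} \<Longrightarrow> w \<in> W \<Longrightarrow> g w - lam * d w (what i) powr p \<le> l i"
    "sum l {1..N} \<le> real N * (s - lam * \<theta> powr p)"
  proof (rule sum_of_suprema[where F = "\<lambda>i w. g w - lam * d w (what i) powr p"])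
    show "finite {1..N}" by simp
    show "what i \<in> W" if "i \<in> {1..N}" for i using that by (rule what)
    show "(\<Sum>i=1..N. g (k i) - lam * d (k i) (what i) powr p) \<le> real N * (s - lam * \<theta> powr p)"
      if "\<And>i. i \<in> {1..N} \<Longrightarrow> k i \<in> W" for k
      using that by (rule selection_le)
  qed (rule that)
  show thesis
  proof
    show "0 \<le> lam" using a b by (simp add: lam_def divide_nonpos_pos)
    show "lam * \<theta> powr p + (\<Sum>i=1..N. l i) / real N \<le> s"
      using l(2) N by (simp add: field_simps)
  qed (use l(1) in auto)
qed

end

section \<open>The Bellman operator as a minimization over actions and multipliers\<close>

theorem proposition1:
  fixes X :: "(real ^ 'n) set" and U :: "(real ^ 'm) set" and W :: "(real ^ 'l) set"
    and f :: "real ^ 'n \<Rightarrow> real ^ 'm \<Rightarrow> real ^ 'l \<Rightarrow> real ^ 'n"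
    and adm :: "real ^ 'n \<Rightarrow> (real ^ 'm) set"
    and c :: "real ^ 'n \<Rightarrow> real ^ 'm \<Rightarrow> real"
    and \<alpha> p \<theta> :: real
    and \<xi> v :: "real ^ 'n \<Rightarrow> real"
    and d :: "real ^ 'l \<Rightarrow> real ^ 'l \<Rightarrow> real"
    and N :: nat and what :: "nat \<Rightarrow> real ^ 'l"
  assumes "X \<in> sets borel" and "U \<in> sets borel" and "W \<in> sets borel"
    and "\<And>x u w. \<lbrakk>x \<in> X; u \<in> U; w \<in> W\<rbrakk> \<Longrightarrow> f x u w \<in> X"
    and "\<And>x. x \<in> X \<Longrightarrow> adm x \<subseteq> U"
    and "0 < \<alpha>" and "\<alpha> < 1"
    and "continuous_on X \<xi>" and "\<And>x. x \<in> X \<Longrightarrow> 1 \<le> \<xi> x"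
    and "Metric_space W d"
    and "(\<lambda>z. d (fst z) (snd z)) \<in> borel_measurable (restrict_space borel (W \<times> W))"
    and "1 \<le> p" and "0 < \<theta>"
    and "1 \<le> N" and "\<And>i. i \<in> {1..N} \<Longrightarrow> what i \<in> W"
    and "v \<in> weighted_space X \<xi>"
    and "\<And>x u. (x, u) \<in> admissible_pairs X U adm \<Longrightarrow>
           integrable (empirical_measure W N what) (\<lambda>w. v (f x u w))"
  shows "\<forall>x\<in>X.
    bellman adm (ambiguity_set p d W (empirical_measure W N what) \<theta>) c f \<alpha> v x =
    Inf {ereal (lam * \<theta> powr p + c x u + (1 / real N) * (\<Sum>i=1..N. ell i)) | u lam ell.
           (\<forall>w\<in>W. \<forall>i\<in>{1..N}. \<alpha> * v (f x u w) - lam * d w (what i) powr p \<le> ell i)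
           \<and> u \<in> adm x \<and> 0 \<le> lam \<and> ell \<in> {1..N} \<rightarrow>\<^sub>E (UNIV :: real set)}"
proof
  fix x assume x: "x \<in> X"
  interpret Metric_space W d by fact
  interpret wasserstein_ball W d p \<theta> N what
    using assms by unfold_locales auto
  let ?D = "ambiguity_set p d W \<nu> \<theta>"
  let ?S = "{ereal (lam * \<theta> powr p + c x u + (1 / real N) * (\<Sum>i=1..N. ell i)) | u lam ell.
           (\<forall>w\<in>W. \<forall>i\<in>{1..N}. \<alpha> * v (f x u w) - lam * d w (what i) powr p \<le> ell i)
           \<and> u \<in> adm x \<and> 0 \<le> lam \<and> ell \<in> {1..N} \<rightarrow>\<^sub>E (UNIV :: real set)}"
  \<comment> \<open>Integrability under \<open>\<nu>\<close> includes measurability, and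
    \<open>\<nu>\<close> has the Borel sets of \<open>W\<close> as its measurable sets.\<close>
  have meas: "(\<lambda>w. v (f x u w)) \<in> borel_measurable BW" if "u \<in> adm x" for u
  proof -
    have "integrable \<nu> (\<lambda>w. v (f x u w))"
      using assms(5,17) x that by (auto simp: admissible_pairs_def)
    then have "(\<lambda>w. v (f x u w)) \<in> borel_measurable \<nu>" by simp
    then show ?thesis using W by (simp cong: measurable_cong_sets)
  qed
  show "bellman adm ?D c f \<alpha> v x = Inf ?S"
  proof (rule antisym)
    show "bellman adm ?D c f \<alpha> v x \<le> Inf ?S"
    proof (rule Inf_greatest, clarify)
      fix u lam and ell :: "nat \<Rightarrow> real"
      assume feas: "\<forall>w\<in>W. \<forall>i\<in>{1..N}. \<alpha> * v (f x u w) - lam * d w (what i) powr p \<le> ell i"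
        and u: "u \<in> adm x" and lam: "0 \<le> lam"
      let ?val = "lam * \<theta> powr p + c x u + (1 / real N) * (\<Sum>i=1..N. ell i)"
      have "ereal (c x u) + ereal \<alpha> * ext_integral \<mu> (\<lambda>w. v (f x u w)) \<le> ereal ?val"
        if \<mu>: "\<mu> \<in> ?D" for \<mu>
      proof -
        \<comment> \<open>In the Bellman operator \<alpha> stands outside the integral, in the
          program it is inside the constraint; dividing \<open>lam\<close> and \<open>ell\<close> by
          \<alpha> reconciles the two.\<close>
        have "ext_integral \<mu> (\<lambda>w. v (f x u w)) \<le>
            ereal (lam / \<alpha> * \<theta> powr p + (\<Sum>i=1..N. ell i / \<alpha>) / real N)"
        proof (rule weak_duality[OF \<mu> meas[OF u]])
          fix w i assume "w \<in> W" "i \<in> {1..N}"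
          then have "(\<alpha> * v (f x u w) - lam * d w (what i) powr p) / \<alpha> \<le> ell i / \<alpha>"
            using feas \<open>0 < \<alpha>\<close> by (intro divide_right_mono) auto
          then show "v (f x u w) - lam / \<alpha> * d w (what i) powr p \<le> ell i / \<alpha>"
            using \<open>0 < \<alpha>\<close> by (simp add: diff_divide_distrib)
        qed (use \<open>0 < \<alpha>\<close> lam in simp)
        then have "ereal (c x u) + ereal \<alpha> * ext_integral \<mu> (\<lambda>w. v (f x u w)) \<le>
            ereal (c x u) +
              ereal \<alpha> * ereal (lam / \<alpha> * \<theta> powr p + (\<Sum>i=1..N. ell i / \<alpha>) / real N)"
          using \<open>0 < \<alpha>\<close> by (intro add_left_mono ereal_mult_left_mono) auto
        also have "\<dots> = ereal ?val"
          using \<open>0 < \<alpha>\<close> by (simp add: sum_divide_distrib[symmetric] field_simps)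
        finally show ?thesis .
      qed
      then have "(SUP \<mu>\<in>?D. ereal (c x u) + ereal \<alpha> * ext_integral \<mu> (\<lambda>w. v (f x u w))) \<le> ereal ?val"
        by (rule SUP_least)
      then show "bellman adm ?D c f \<alpha> v x \<le> ereal ?val"
        unfolding bellman_def by (rule INF_lower2[OF u])
    qed
    show "Inf ?S \<le> bellman adm ?D c f \<alpha> v x"
      unfolding bellman_def
    \<comment> \<open>It suffices to treat real upper bounds \<open>z\<close> of the inner supremum;
      if that supremum is infinite there are none.\<close>
    proof (rule INF_greatest, rule ereal_le_real)
      fix u z
      assume u: "u \<in> adm x"
        and z: "(SUP \<mu>\<in>?D. ereal (c x u) + ereal \<alpha> * ext_integral \<mu> (\<lambda>w. v (f x u w))) \<le> ereal z"
      have "ext_integral \<mu> (\<lambda>w. v (f x u w)) \<le> ereal ((z - c x u) / \<alpha>)" if "\<mu> \<in> ?D" for \<mu>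
      proof -
        have "ereal (c x u) + ereal \<alpha> * ext_integral \<mu> (\<lambda>w. v (f x u w)) \<le> ereal z"
          by (rule order.trans[OF SUP_upper z]) (rule that)
        then show ?thesis using \<open>0 < \<alpha>\<close>
          by (cases "ext_integral \<mu> (\<lambda>w. v (f x u w))") (simp_all add: pos_le_divide_eq algebra_simps)
      qed
      from strong_duality[OF meas[OF u] this] obtain lam l where lam: "0 \<le> lam"
        and l: "\<And>w i. w \<in> W \<Longrightarrow> i \<in> {1..N} \<Longrightarrow> v (f x u w) - lam * d w (what i) powr p \<le> l i"
        and le: "lam * \<theta> powr p + (\<Sum>i=1..N. l i) / real N \<le> (z - c x u) / \<alpha>"
        by blast
      \<comment> \<open>Multiplication by \<alpha> returns to the scale of the program;
        \<open>restrict\<close> makes \<open>ell\<close> undefined outside the indices, as the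
        extensional function space demands.\<close>
      define ell where "ell = restrict (\<lambda>i. \<alpha> * l i) {1..N}"
      have sum_ell: "(\<Sum>i=1..N. ell i) = \<alpha> * (\<Sum>i=1..N. l i)"
        by (simp add: ell_def sum_distrib_left)
      have "\<alpha> * v (f x u w) - \<alpha> * lam * d w (what i) powr p \<le> ell i" if "w \<in> W" "i \<in> {1..N}" for w i
        using mult_left_mono[OF l[OF that], of \<alpha>] that \<open>0 < \<alpha>\<close> by (simp add: ell_def algebra_simps)
      then have "ereal (\<alpha> * lam * \<theta> powr p + c x u + (1 / real N) * (\<Sum>i=1..N. ell i)) \<in> ?S"
        using u lam \<open>0 < \<alpha>\<close>
        by (intro CollectI exI[of _ u] exI[of _ "\<alpha> * lam"] exI[of _ ell]) (auto simp: ell_def)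
      then have "Inf ?S \<le> ereal (\<alpha> * lam * \<theta> powr p + c x u + (1 / real N) * (\<Sum>i=1..N. ell i))"
        by (rule Inf_lower)
      also have "\<dots> \<le> ereal z"
        using le \<open>0 < \<alpha>\<close> unfolding sum_ell by (simp add: pos_le_divide_eq algebra_simps)
      finally show "Inf ?S \<le> ereal z" .
    qed
  qed
qed

end
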